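(* Let $\mathcal H,\mathcal K$ be finite-dimensional complex Hilbert spaces, let $\Phi:B(\mathcal H)\to B(\mathcal K)$ be a quantum channel, let $\Phi(\rho)=\sum_{i=1}^{r}A_i\rho A_i^{*}$ be a Kraus representation of $\Phi$ with $\mathcal A=\{A_i\}_{i=1}^{r}\subset B(\mathcal H,\mathcal K)$, and let $\Phi_{\mathcal A}^{c}$ be the complementary channel associated with $\mathcal A$. Then $\Phi$ is phase retrievable if and only if $\Phi_{\mathcal A}^{c}$ is pure-state informationally complete.
   Context: A quantum channel $\Phi:B(\mathcal H)\to B(\mathcal K)$ is a completely positive trace preserving linear map; a Kraus representation is an expression $\Phi(\rho)=\sum_i A_i\rho A_i^*$ with finitely many $A_i\in B(\mathcal H,\mathcal K)$ (so $\sum_i A_i^*A_i=I_{\mathcal H}$). $\Phi^*$ denotes the adjoint of $\Phi$ for the Hilbert–Schmidt inner product, $\Phi^*(X)=\sum_i A_i^*XA_i$. For a unit vector $x$, $\rho_x=|x\rangle\langle x|$. A POVM on $\mathcal K$ is a finite family of positive semidefinite operators $\{F_j\}_{j=1}^N\subset B(\mathcal K)$ with $\sum_j F_j=I_{\mathcal K}$. Phase retrievable: $\Phi$ is phase retrievable if there exists a POVM $\{F_j\}_{j=1}^{N}$ on $\mathcal K$ such that, for all unit vectors $x,y\in\mathcal H$, $\operatorname{Tr}(\rho_x\Phi^*(F_j))=\operatorname{Tr}(\rho_y\Phi^*(F_j))$ for all $j$ implies $\rho_x=\rho_y$. Complementary channel associated with $\mathcal A$: $\Phi_{\mathcal A}^{c}:B(\mathcal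 H)\to B(\mathbb C^r)$, $\Phi_{\mathcal A}^{c}(\rho)=\sum_{i,j=1}^{r}\operatorname{Tr}(A_i\rho A_j^{*})\,|i\rangle\langle j|$, where $\{|i\rangle\}_{i=1}^r$ is the standard orthonormal basis of $\mathbb C^r$. Pure-state informationally complete (PSIC): a family of operators $\{E_\alpha\}_{\alpha\in\Lambda}$ on a finite-dimensional Hilbert space $\mathcal H$ is PSIC if for all unit vectors $x,y\in\mathcal H$, $\langle E_\alpha x,x\rangle=\langle E_\alpha y,y\rangle$ for all $\alpha\in\Lambda$ implies $x=e^{i\theta}y$ for some $\theta\in\mathbb R$. A quantum channel $\Psi$ is PSIC if there exists a Kraus representation $\Psi(\rho)=\sum_{i=1}^{s}C_i\rho C_i^*$ such that the family $\{C_j^*C_i:1\le i,j\le s\}$ is PSIC. *)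

theory Defs
  imports Complex_Main "Jordan_Normal_Form.Schur_Decomposition"
begin

text \<open>
  The \<open>n\<close>-dimensional complex Hilbert space is \<open>carrier_vec n\<close> over the complex numbers, with the
  inner product \<open>x \<bullet>c y\<close>, which is linear in \<open>x\<close> and conjugate-linear in \<open>y\<close>.  Operators from the
  \<open>n\<close>-dimensional to the \<open>m\<close>-dimensional space are the matrices in \<open>carrier_mat m n\<close>, and a family
  \<open>A\<^sub>1, \<dots>, A\<^sub>r\<close> is a function on \<open>nat\<close> of which only the values at indices \<open>< r\<close> matter.
  A map from operators to operators is a function on \<open>complex mat\<close> of which only the values on the
  relevant carrier matter.
\<close>

definition unit_vector :: "nat \<Rightarrow> complex vec \<Rightarrow> bool" where
  "unit_vector n x \<longleftrightarrow> x \<in> carrier_vec n \<and> x \<bullet>c x = 1"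

definition trace :: "complex mat \<Rightarrow> complex" where
  "trace A = (\<Sum>i<dim_row A. A $$ (i, i))"

definition msum :: "nat \<Rightarrow> nat \<Rightarrow> (nat \<Rightarrow> complex mat) \<Rightarrow> nat \<Rightarrow> complex mat" where
  "msum m n B r = mat m n (\<lambda>(i, j). \<Sum>k<r. B k $$ (i, j))"

definition rank_one_proj :: "complex vec \<Rightarrow> complex mat" where
  "rank_one_proj x = mat (dim_vec x) (dim_vec x) (\<lambda>(i, j). x $ i * cnj (x $ j))"

text \<open>In the order on the complex numbers, \<open>0 \<le> z\<close> means that \<open>z\<close> is real and nonnegative.\<close>

definition psd :: "nat \<Rightarrow> complex mat \<Rightarrow> bool" where
  "psd n A \<longleftrightarrow> A \<in> carrier_mat n n \<and> (\<forall>v \<in> carrier_vec n. 0 \<le> (A *\<^sub>v v) \<bullet>c v)"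

definition linear_super :: "nat \<Rightarrow> nat \<Rightarrow> (complex mat \<Rightarrow> complex mat) \<Rightarrow> bool" where
  "linear_super n m \<Phi> \<longleftrightarrow>
     (\<forall>X \<in> carrier_mat n n. \<Phi> X \<in> carrier_mat m m) \<and>
     (\<forall>X \<in> carrier_mat n n. \<forall>Y \<in> carrier_mat n n. \<Phi> (X + Y) = \<Phi> X + \<Phi> Y) \<and>
     (\<forall>c. \<forall>X \<in> carrier_mat n n. \<Phi> (c \<cdot>\<^sub>m X) = c \<cdot>\<^sub>m \<Phi> X)"

text \<open>
  A matrix of size \<open>k * n\<close> is read as a \<open>k\<close> by \<open>k\<close> matrix of blocks of size \<open>n\<close>; the map
  \<open>id\<^sub>k \<otimes> \<Phi>\<close> applies \<open>\<Phi>\<close> to each block.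
\<close>

definition block :: "nat \<Rightarrow> complex mat \<Rightarrow> nat \<Rightarrow> nat \<Rightarrow> complex mat" where
  "block n X a b = mat n n (\<lambda>(i, j). X $$ (a * n + i, b * n + j))"

definition ampliation ::
  "nat \<Rightarrow> nat \<Rightarrow> nat \<Rightarrow> (complex mat \<Rightarrow> complex mat) \<Rightarrow> complex mat \<Rightarrow> complex mat" where
  "ampliation k n m \<Phi> X =
     mat (k * m) (k * m) (\<lambda>(p, q). \<Phi> (block n X (p div m) (q div m)) $$ (p mod m, q mod m))"

definition completely_positive :: "nat \<Rightarrow> nat \<Rightarrow> (complex mat \<Rightarrow> complex mat) \<Rightarrow> bool" where
  "completely_positive n m \<Phi> \<longleftrightarrow>
     (\<forall>k X. psd (k * n) X \<longrightarrow> psd (k * m) (ampliation k n m \<Phi> X))"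

definition quantum_channel :: "nat \<Rightarrow> nat \<Rightarrow> (complex mat \<Rightarrow> complex mat) \<Rightarrow> bool" where
  "quantum_channel n m \<Phi> \<longleftrightarrow>
     linear_super n m \<Phi> \<and> completely_positive n m \<Phi> \<and>
     (\<forall>X \<in> carrier_mat n n. trace (\<Phi> X) = trace X)"

text \<open>For a trace preserving \<open>\<Phi>\<close> the identity \<open>\<Sum>\<^sub>i A\<^sub>i\<^sup>* A\<^sub>i = I\<close> is a consequence, so it is not required.\<close>

definition kraus_representation ::
  "nat \<Rightarrow> nat \<Rightarrow> (complex mat \<Rightarrow> complex mat) \<Rightarrow> nat \<Rightarrow> (nat \<Rightarrow> complex mat) \<Rightarrow> bool" where
  "kraus_representation n m \<Phi> r A \<longleftrightarrow>
     (\<forall>i<r. A i \<in> carrier_mat m n) \<and>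
     (\<forall>\<rho> \<in> carrier_mat n n. \<Phi> \<rho> = msum m m (\<lambda>i. A i * \<rho> * mat_adjoint (A i)) r)"

definition hs_inner :: "complex mat \<Rightarrow> complex mat \<Rightarrow> complex" where
  "hs_inner X Y = trace (X * mat_adjoint Y)"

text \<open>For linear \<open>\<Phi>\<close> and \<open>X\<close> in \<open>carrier_mat m m\<close> the described operator exists and is unique.\<close>

definition hs_adjoint ::
  "nat \<Rightarrow> nat \<Rightarrow> (complex mat \<Rightarrow> complex mat) \<Rightarrow> complex mat \<Rightarrow> complex mat" where
  "hs_adjoint n m \<Phi> X =
     (THE Y. Y \<in> carrier_mat n n \<and>
        (\<forall>\<rho> \<in> carrier_mat n n. hs_inner (\<Phi> \<rho>) X = hs_inner \<rho> Y))"

definition povm :: "nat \<Rightarrow> nat \<Rightarrow> (nat \<Rightarrow> complex mat) \<Rightarrow> bool" where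
  "povm m N F \<longleftrightarrow> (\<forall>j<N. psd m (F j)) \<and> msum m m F N = 1\<^sub>m m"

definition phase_retrievable :: "nat \<Rightarrow> nat \<Rightarrow> (complex mat \<Rightarrow> complex mat) \<Rightarrow> bool" where
  "phase_retrievable n m \<Phi> \<longleftrightarrow>
     (\<exists>N F. povm m N F \<and>
        (\<forall>x y. unit_vector n x \<longrightarrow> unit_vector n y \<longrightarrow>
           (\<forall>j<N. trace (rank_one_proj x * hs_adjoint n m \<Phi> (F j))
                 = trace (rank_one_proj y * hs_adjoint n m \<Phi> (F j))) \<longrightarrow>
           rank_one_proj x = rank_one_proj y))"

definition complementary_channel ::
  "nat \<Rightarrow> (nat \<Rightarrow> complex mat) \<Rightarrow> complex mat \<Rightarrow> complex mat" where
  "complementary_channel r A \<rho> = mat r r (\<lambda>(i, j). trace (A i * \<rho> * mat_adjoint (A j)))"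

definition psic_family :: "nat \<Rightarrow> 'i set \<Rightarrow> ('i \<Rightarrow> complex mat) \<Rightarrow> bool" where
  "psic_family n \<Lambda> E \<longleftrightarrow>
     (\<forall>x y. unit_vector n x \<longrightarrow> unit_vector n y \<longrightarrow>
        (\<forall>\<alpha>\<in>\<Lambda>. (E \<alpha> *\<^sub>v x) \<bullet>c x = (E \<alpha> *\<^sub>v y) \<bullet>c y) \<longrightarrow>
        (\<exists>\<theta>::real. x = exp (\<i> * complex_of_real \<theta>) \<cdot>\<^sub>v y))"

definition psic_channel :: "nat \<Rightarrow> nat \<Rightarrow> (complex mat \<Rightarrow> complex mat) \<Rightarrow> bool" where
  "psic_channel n m \<Psi> \<longleftrightarrow>
     quantum_channel n m \<Psi> \<and>
     (\<exists>s C. kraus_representation n m \<Psi> s C \<and>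
        psic_family n ({..<s} \<times> {..<s}) (\<lambda>(i, j). mat_adjoint (C j) * C i))"

end

theory Submission
  imports Defs
begin

text \<open>
  A POVM that determines every operator exists, so \<open>\<Phi>\<close> is phase retrievable iff \<open>\<Phi> (\<rho>\<^sub>x)\<close> determines
  \<open>\<rho>\<^sub>x\<close> among pure states.  The complementary channel has the Kraus operators
  \<open>B\<^sub>a x = ((A\<^sub>i x)\<^sub>a)\<^sub>i\<close>, and the numbers \<open>\<langle>B\<^sub>b\<^sup>* B\<^sub>a x, x\<rangle>\<close> are the entries of \<open>\<Phi> (\<rho>\<^sub>x)\<close>.  Any two
  Kraus representations of a channel span the same space of operators, because a vector orthogonal
  to one family is orthogonal to the other; hence for every other representation \<open>C\<close> the
  numbers \<open>\<langle>C\<^sub>d\<^sup>* C\<^sub>c x, x\<rangle>\<close> are functions of \<open>\<Phi> (\<rho>\<^sub>x)\<close> as well.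
\<close>

section \<open>Coordinate formulas for adjoints, quadratic forms and traces\<close>

lemma dim_mat_adjoint [simp]:
  "dim_row (mat_adjoint A) = dim_col A" "dim_col (mat_adjoint A) = dim_row A"
  by (auto simp: mat_adjoint_def)

lemma index_mat_adjoint [simp]:
  fixes A :: "complex mat"
  assumes "i < dim_col A" "j < dim_row A"
  shows "mat_adjoint A $$ (i, j) = cnj (A $$ (j, i))"
  using assms by (simp add: mat_adjoint_def mat_of_rows_index)

lemma cscalar_prod_sum:
  fixes x y :: "complex vec"
  assumes "y \<in> carrier_vec n"
  shows "x \<bullet>c y = (\<Sum>i<n. x $ i * cnj (y $ i))"
  using assms by (auto simp: scalar_prod_def lessThan_atLeast0 intro!: sum.cong)

lemma index_mult_mat_vec_sum:
  assumes "A \<in> carrier_mat m n" "v \<in> carrier_vec n" "i < m"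
  shows "(A *\<^sub>v v) $ i = (\<Sum>j<n. A $$ (i, j) * v $ j)"
  using assms by (auto simp: scalar_prod_def lessThan_atLeast0 intro!: sum.cong)

lemma index_mult_mat_sum:
  assumes "A \<in> carrier_mat m n" "B \<in> carrier_mat n l" "i < m" "j < l"
  shows "(A * B) $$ (i, j) = (\<Sum>k<n. A $$ (i, k) * B $$ (k, j))"
  using assms by (auto simp: scalar_prod_def lessThan_atLeast0 intro!: sum.cong)

lemma quadratic_form_sum:
  fixes X :: "complex mat"
  assumes "X \<in> carrier_mat n n" "v \<in> carrier_vec n"
  shows "(X *\<^sub>v v) \<bullet>c v = (\<Sum>p<n. \<Sum>q<n. X $$ (p, q) * v $ q * cnj (v $ p))"
  using assms
  by (simp add: cscalar_prod_sum index_mult_mat_vec_sum sum_distrib_right del: index_mult_mat_vec)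

lemma index_sandwich:
  fixes A B X :: "complex mat"
  assumes A: "A \<in> carrier_mat m n" and B: "B \<in> carrier_mat l n" and X: "X \<in> carrier_mat n n"
    and i: "i < m" and j: "j < l"
  shows "(A * X * mat_adjoint B) $$ (i, j)
    = (\<Sum>u<n. \<Sum>w<n. A $$ (i, u) * X $$ (u, w) * cnj (B $$ (j, w)))"
proof -
  have AX: "A * X \<in> carrier_mat m n" using A X by auto
  have Bt: "mat_adjoint B \<in> carrier_mat n l" using B by (auto intro: carrier_matI)
  have "(A * X * mat_adjoint B) $$ (i, j)
      = (\<Sum>w<n. (\<Sum>u<n. A $$ (i, u) * X $$ (u, w)) * cnj (B $$ (j, w)))"
    unfolding index_mult_mat_sum[OF AX Bt i j]
    using B j by (intro sum.cong refl, subst index_mult_mat_sum[OF A X i]) auto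
  also have "\<dots> = (\<Sum>w<n. \<Sum>u<n. A $$ (i, u) * X $$ (u, w) * cnj (B $$ (j, w)))"
    by (simp add: sum_distrib_right)
  finally show ?thesis by (subst sum.swap)
qed

lemma hs_inner_sum:
  assumes "X \<in> carrier_mat m n" "Y \<in> carrier_mat m n"
  shows "hs_inner X Y = (\<Sum>i<m. \<Sum>j<n. X $$ (i, j) * cnj (Y $$ (i, j)))"
proof -
  have Yt: "mat_adjoint Y \<in> carrier_mat n m" using assms by (auto intro: carrier_matI)
  have "hs_inner X Y = (\<Sum>i<m. (X * mat_adjoint Y) $$ (i, i))"
    using assms by (simp add: hs_inner_def trace_def)
  also have "\<dots> = (\<Sum>i<m. \<Sum>j<n. X $$ (i, j) * cnj (Y $$ (i, j)))"
    using assms by (intro sum.cong refl, subst index_mult_mat_sum[OF assms(1) Yt]) auto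
  finally show ?thesis .
qed

section \<open>Pure states and equality up to a phase\<close>

lemma rank_one_proj_carrier [simp]: "x \<in> carrier_vec n \<Longrightarrow> rank_one_proj x \<in> carrier_mat n n"
  by (simp add: rank_one_proj_def)

lemma index_rank_one_proj [simp]:
  "\<lbrakk>x \<in> carrier_vec n; i < n; j < n\<rbrakk> \<Longrightarrow> rank_one_proj x $$ (i, j) = x $ i * cnj (x $ j)"
  by (simp add: rank_one_proj_def)

text \<open>The projection is self-adjoint, so dropping the adjoint on \<open>Y\<close> only
  conjugates the value. This translates the trace in \<open>phase_retrievable\<close> into the inner
  product by which \<open>hs_adjoint\<close> is specified.\<close>

lemma trace_rank_one_proj_mult:
  assumes x: "x \<in> carrier_vec n" and Y: "Y \<in> carrier_mat n n"
  shows "trace (rank_one_proj x * Y) = cnj (hs_inner (rank_one_proj x) Y)"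
proof -
  have P: "rank_one_proj x \<in> carrier_mat n n" using x by simp
  have "trace (rank_one_proj x * Y) = (\<Sum>i<n. (rank_one_proj x * Y) $$ (i, i))"
    using P by (simp add: trace_def)
  also have "\<dots> = (\<Sum>i<n. \<Sum>j<n. x $ i * cnj (x $ j) * Y $$ (j, i))"
    using x by (intro sum.cong refl, subst index_mult_mat_sum[OF P Y]) auto
  also have "\<dots> = (\<Sum>j<n. \<Sum>i<n. x $ i * cnj (x $ j) * Y $$ (j, i))"
    by (rule sum.swap)
  also have "\<dots> = cnj (hs_inner (rank_one_proj x) Y)"
    using x by (simp add: hs_inner_sum[OF P Y] mult.commute)
  finally show ?thesis .
qed

lemma unit_vector_sum:
  "unit_vector n x \<Longrightarrow> (\<Sum>i<n. x $ i * cnj (x $ i)) = 1"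
  by (metis unit_vector_def cscalar_prod_sum)

text \<open>Bridges the conclusions of \<open>phase_retrievable\<close> and
  \<open>psic_family\<close>: equal projections force \<open>x\<close> to be a multiple of
  \<open>y\<close>, and the equal norms force the factor onto the unit circle.\<close>

lemma rank_one_proj_eq_iff:
  assumes x: "unit_vector n x" and y: "unit_vector n y"
  shows "rank_one_proj x = rank_one_proj y \<longleftrightarrow> (\<exists>\<theta>::real. x = exp (\<i> * complex_of_real \<theta>) \<cdot>\<^sub>v y)"
proof
  have xc: "x \<in> carrier_vec n" and yc: "y \<in> carrier_vec n"
    using x y by (auto simp: unit_vector_def)
  assume "rank_one_proj x = rank_one_proj y"
  then have eq: "x $ i * cnj (x $ j) = y $ i * cnj (y $ j)" if "i < n" "j < n" for i j
    using that xc yc by (metis index_rank_one_proj)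
  \<comment> \<open>Multiplying \<open>eq\<close> by \<open>x $ j\<close> and summing over
    \<open>j\<close> turns the left side into \<open>x $ i\<close>, because \<open>x\<close> has
    norm one; the right side is then \<open>c * y $ i\<close>.\<close>
  define c where "c = (\<Sum>j<n. cnj (y $ j) * x $ j)"
  have xi: "x $ i = c * y $ i" if "i < n" for i
  proof -
    have "x $ i = (\<Sum>j<n. x $ i * cnj (x $ j) * x $ j)"
      using unit_vector_sum[OF x]
      by (simp add: mult.assoc mult.commute[of "cnj _"] flip: sum_distrib_left)
    also have "\<dots> = (\<Sum>j<n. y $ i * cnj (y $ j) * x $ j)"
      using that by (intro sum.cong refl) (simp add: eq)
    finally show ?thesis
      by (simp add: c_def sum_distrib_left mult_ac)
  qed
  have "1 = (\<Sum>i<n. (c * cnj c) * (y $ i * cnj (y $ i)))"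
    unfolding unit_vector_sum[OF x, symmetric] by (intro sum.cong refl) (simp add: xi)
  also have "\<dots> = c * cnj c"
    by (simp add: unit_vector_sum[OF y] flip: sum_distrib_left)
  finally have "complex_of_real ((cmod c)\<^sup>2) = complex_of_real 1"
    by (simp only: complex_norm_square of_real_1)
  then have "(cmod c)\<^sup>2 = 1" by (simp only: of_real_eq_iff)
  then have c1: "cmod c = 1" using norm_ge_zero[of c] by (auto simp: power2_eq_1_iff)
  then have "c \<noteq> 0" by auto
  then have "c = exp (\<i> * complex_of_real (Arg c))"
    using cis_Arg[of c] c1 by (simp add: sgn_eq cis_conv_exp)
  moreover have "x = c \<cdot>\<^sub>v y"
    using xc yc by (intro eq_vecI) (auto simp: xi)
  ultimately show "\<exists>\<theta>::real. x = exp (\<i> * complex_of_real \<theta>) \<cdot>\<^sub>v y" by metis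
next
  have yc: "y \<in> carrier_vec n" using y by (simp add: unit_vector_def)
  assume "\<exists>\<theta>::real. x = exp (\<i> * complex_of_real \<theta>) \<cdot>\<^sub>v y"
  then obtain \<theta> :: real where x: "x = cis \<theta> \<cdot>\<^sub>v y" by (auto simp: cis_conv_exp)
  have "cis \<theta> * cnj (cis \<theta>) = 1" by (simp add: cis_cnj cis_mult)
  then have "(cis \<theta> * a) * cnj (cis \<theta> * b) = a * cnj b" for a b
    by (metis (no_types) complex_cnj_mult mult.assoc mult.left_commute mult_1)
  then show "rank_one_proj x = rank_one_proj y"
    using yc unfolding x rank_one_proj_def by (intro eq_matI) (auto simp del: complex_cnj_mult)
qed


section \<open>Kraus maps in coordinates and their Hilbert-Schmidt adjoints\<close>

lemma kraus_carrier:
  "\<lbrakk>kraus_representation n m \<Phi> s C; c < s\<rbrakk> \<Longrightarrow> C c \<in> carrier_mat m n"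
  by (simp add: kraus_representation_def)

lemma kraus_image_carrier:
  "\<lbrakk>kraus_representation n m \<Phi> s C; X \<in> carrier_mat n n\<rbrakk> \<Longrightarrow> \<Phi> X \<in> carrier_mat m m"
  by (simp add: kraus_representation_def msum_def)

lemma index_kraus:
  assumes "kraus_representation n m \<Phi> s C" "X \<in> carrier_mat n n" "i < m" "j < m"
  shows "\<Phi> X $$ (i, j)
    = (\<Sum>c<s. \<Sum>u<n. \<Sum>w<n. C c $$ (i, u) * X $$ (u, w) * cnj (C c $$ (j, w)))"
proof -
  have "\<Phi> X $$ (i, j) = (\<Sum>c<s. (C c * X * mat_adjoint (C c)) $$ (i, j))"
    using assms by (simp add: kraus_representation_def msum_def)
  also have "\<dots> = (\<Sum>c<s. \<Sum>u<n. \<Sum>w<n. C c $$ (i, u) * X $$ (u, w) * cnj (C c $$ (j, w)))"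
    using assms(2-4) by (intro sum.cong refl index_sandwich) (auto intro: kraus_carrier[OF assms(1)])
  finally show ?thesis .
qed

lemma index_kraus_rank_one:
  assumes K: "kraus_representation n m \<Phi> s C" and x: "x \<in> carrier_vec n" and "i < m" "j < m"
  shows "\<Phi> (rank_one_proj x) $$ (i, j) = (\<Sum>c<s. (C c *\<^sub>v x) $ i * cnj ((C c *\<^sub>v x) $ j))"
  using assms
  by (simp add: index_kraus index_mult_mat_vec_sum[OF kraus_carrier[OF K]] sum_product algebra_simps
      del: index_mult_mat_vec)

text \<open>Testing against a matrix unit reads off the conjugate of a single entry. This supplies
  the uniqueness behind the definite description in \<open>hs_adjoint\<close>.\<close>

lemma hs_inner_unique:
  assumes Y: "Y \<in> carrier_mat n n" and Z: "Z \<in> carrier_mat n n"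
    and eq: "\<And>\<rho>. \<rho> \<in> carrier_mat n n \<Longrightarrow> hs_inner \<rho> Y = hs_inner \<rho> Z"
  shows "Y = Z"
proof (rule eq_matI)
  fix i j assume "i < dim_row Z" "j < dim_col Z"
  with Z have ij: "i < n" "j < n" by auto
  define E :: "complex mat" where "E = mat n n (\<lambda>(a, b). if a = i \<and> b = j then 1 else 0)"
  have E: "E \<in> carrier_mat n n" by (simp add: E_def)
  have "hs_inner E W = cnj (W $$ (i, j))" if W: "W \<in> carrier_mat n n" for W
  proof -
    have "hs_inner E W = (\<Sum>a<n. \<Sum>b<n. if a = i then if b = j then cnj (W $$ (a, b)) else 0 else 0)"
      unfolding hs_inner_sum[OF E W] by (intro sum.cong refl) (auto simp: E_def)
    \<comment> \<open>With the inner sum moved under the outer condition, each sum has a single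
      nonzero term and collapses.\<close>
    also have "\<dots> = (\<Sum>a<n. if a = i then \<Sum>b<n. if b = j then cnj (W $$ (a, b)) else 0 else 0)"
      by (intro sum.cong refl) auto
    also have "\<dots> = cnj (W $$ (i, j))" using ij by simp
    finally show ?thesis .
  qed
  then show "Y $$ (i, j) = Z $$ (i, j)"
    using eq[OF E] Y Z by simp
qed (use Y Z in auto)

lemma hs_adjoint_works:
  assumes K: "kraus_representation n m \<Phi> r A" and X: "X \<in> carrier_mat m m"
  shows "hs_adjoint n m \<Phi> X \<in> carrier_mat n n"
    and "\<rho> \<in> carrier_mat n n \<Longrightarrow> hs_inner (\<Phi> \<rho>) X = hs_inner \<rho> (hs_adjoint n m \<Phi> X)"
proof -
  \<comment> \<open>These are the entries of the sum over \<open>c\<close> of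
    \<open>mat_adjoint (A c) * X * A c\<close>, the usual formula for the adjoint of a Kraus
    map.\<close>
  define Y where "Y = mat n n (\<lambda>(u, w). \<Sum>c<r. \<Sum>i<m. \<Sum>j<m.
    cnj (A c $$ (i, u)) * X $$ (i, j) * A c $$ (j, w))"
  have Y: "Y \<in> carrier_mat n n" by (simp add: Y_def)
  have "hs_inner (\<Phi> \<rho>) X = hs_inner \<rho> Y" if \<rho>: "\<rho> \<in> carrier_mat n n" for \<rho>
  proof -
    let ?f = "\<lambda>i j c u w. \<rho> $$ (u, w) * (A c $$ (i, u) * (cnj (X $$ (i, j)) * cnj (A c $$ (j, w))))"
    have "hs_inner (\<Phi> \<rho>) X = (\<Sum>i<m. \<Sum>j<m. \<Sum>c<r. \<Sum>u<n. \<Sum>w<n. ?f i j c u w)"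
      unfolding hs_inner_sum[OF kraus_image_carrier[OF K \<rho>] X]
      by (intro sum.cong refl, subst index_kraus[OF K \<rho>])
        (auto simp: sum_distrib_left sum_distrib_right mult_ac)
    \<comment> \<open>Flattening the five sums into one over a product set lets a single bijection
      of index tuples do all the interchanges.\<close>
    also have "\<dots> = (\<Sum>(i, j, c, u, w)\<in>{..<m} \<times> {..<m} \<times> {..<r} \<times> {..<n} \<times> {..<n}. ?f i j c u w)"
      by (simp add: sum.cartesian_product)
    also have "\<dots> = (\<Sum>(u, w, c, i, j)\<in>{..<n} \<times> {..<n} \<times> {..<r} \<times> {..<m} \<times> {..<m}. ?f i j c u w)"
      by (rule sum.reindex_bij_witness[where i = "\<lambda>(u, w, c, i, j). (i, j, c, u, w)"
            and j = "\<lambda>(i, j, c, u, w). (u, w, c, i, j)"]) auto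
    also have "\<dots> = (\<Sum>u<n. \<Sum>w<n. \<Sum>c<r. \<Sum>i<m. \<Sum>j<m. ?f i j c u w)"
      by (simp add: sum.cartesian_product)
    also have "\<dots> = hs_inner \<rho> Y"
      unfolding hs_inner_sum[OF \<rho> Y] by (simp add: Y_def sum_distrib_left mult_ac)
    finally show ?thesis .
  qed
  then have "\<exists>!Y. Y \<in> carrier_mat n n \<and> (\<forall>\<rho> \<in> carrier_mat n n. hs_inner (\<Phi> \<rho>) X = hs_inner \<rho> Y)"
    using Y by (intro ex1I[of _ Y]) (auto intro!: hs_inner_unique)
  from theI'[OF this]
  show "hs_adjoint n m \<Phi> X \<in> carrier_mat n n"
    and "\<rho> \<in> carrier_mat n n \<Longrightarrow> hs_inner (\<Phi> \<rho>) X = hs_inner \<rho> (hs_adjoint n m \<Phi> X)"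
    by (auto simp: hs_adjoint_def)
qed

text \<open>Measurement values depend on \<open>x\<close> only through
  \<open>\<Phi> (rank_one_proj x)\<close>. The conjugate does not affect whether two such values
  agree.\<close>

lemma trace_hs_adjoint:
  assumes K: "kraus_representation n m \<Phi> r A" and X: "X \<in> carrier_mat m m" and x: "x \<in> carrier_vec n"
  shows "trace (rank_one_proj x * hs_adjoint n m \<Phi> X) = cnj (hs_inner (\<Phi> (rank_one_proj x)) X)"
  using trace_rank_one_proj_mult[OF x hs_adjoint_works(1)[OF K X]]
    hs_adjoint_works(2)[OF K X rank_one_proj_carrier[OF x]] by simp

section \<open>Orthogonal decomposition and the common span of Kraus families\<close>

lemma sum_mult_cnj_eq_0_iff:
  fixes f :: "'a \<Rightarrow> complex"
  assumes "finite S"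
  shows "(\<Sum>s\<in>S. f s * cnj (f s)) = 0 \<longleftrightarrow> (\<forall>s\<in>S. f s = 0)"
proof -
  have "(\<Sum>s\<in>S. f s * cnj (f s)) = complex_of_real (\<Sum>s\<in>S. (cmod (f s))\<^sup>2)"
    by (simp add: complex_norm_square del: of_real_power)
  then show ?thesis using assms by (simp only: of_real_eq_0_iff) (simp add: sum_nonneg_eq_0_iff)
qed

text \<open>Gram-Schmidt by induction on \<open>k\<close>, for functions on \<open>S\<close> that
  may be linearly dependent. The vector \<open>v\<close> is generalized because the induction
  hypothesis is applied twice, to \<open>v\<close> and to the new vector \<open>w k\<close>.\<close>

lemma orthogonal_decomposition:
  fixes w :: "nat \<Rightarrow> 'a \<Rightarrow> complex"
  assumes "finite S"
  shows "\<exists>c u. (\<forall>s\<in>S. v s = (\<Sum>a<k. c a * w a s) + u s) \<and> (\<forall>a<k. (\<Sum>s\<in>S. u s * cnj (w a s)) = 0)"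
proof (induction k arbitrary: v)
  case 0
  show ?case by (intro exI[of _ v] exI[of _ "\<lambda>_. 0"]) simp
next
  case (Suc k)
  obtain c u where v: "\<And>s. s \<in> S \<Longrightarrow> v s = (\<Sum>a<k. c a * w a s) + u s"
    and u: "\<And>a. a < k \<Longrightarrow> (\<Sum>s\<in>S. u s * cnj (w a s)) = 0"
    using Suc.IH[of v] by blast
  obtain d p where wk: "\<And>s. s \<in> S \<Longrightarrow> w k s = (\<Sum>a<k. d a * w a s) + p s"
    and p: "\<And>a. a < k \<Longrightarrow> (\<Sum>s\<in>S. p s * cnj (w a s)) = 0"
    using Suc.IH[of "w k"] by blast
  \<comment> \<open>\<open>z\<close> is the coefficient of \<open>u\<close> along \<open>p\<close>.
    If \<open>w k\<close> already lies in the earlier span, then \<open>p\<close> vanishes on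
    \<open>S\<close>, the quotient is 0 by division by zero, and \<open>u'p\<close> holds
    trivially.\<close>
  define z where "z = (\<Sum>s\<in>S. u s * cnj (p s)) / (\<Sum>s\<in>S. p s * cnj (p s))"
  define u' where "u' s = u s - z * p s" for s
  \<comment> \<open>Since \<open>p\<close> is \<open>w k\<close> minus the combination with
    coefficients \<open>d a\<close>, adding \<open>z * p\<close> means adding \<open>z * w k\<close>
    and lowering the earlier coefficients by \<open>z * d a\<close>.\<close>
  define c' where "c' a = (if a < k then c a - z * d a else z)" for a
  have u'w: "(\<Sum>s\<in>S. u' s * cnj (w a s)) = 0" if "a < k" for a
  proof -
    have "(\<Sum>s\<in>S. u' s * cnj (w a s)) = (\<Sum>s\<in>S. u s * cnj (w a s)) - z * (\<Sum>s\<in>S. p s * cnj (w a s))"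
      by (simp add: u'_def algebra_simps sum_subtractf sum_distrib_left)
    then show ?thesis using u p that by simp
  qed
  have u'p: "(\<Sum>s\<in>S. u' s * cnj (p s)) = 0"
  proof (cases "(\<Sum>s\<in>S. p s * cnj (p s)) = 0")
    case True
    then show ?thesis using assms by (simp add: sum_mult_cnj_eq_0_iff)
  next
    case False
    have "(\<Sum>s\<in>S. u' s * cnj (p s)) = (\<Sum>s\<in>S. u s * cnj (p s)) - z * (\<Sum>s\<in>S. p s * cnj (p s))"
      by (simp add: u'_def algebra_simps sum_subtractf sum_distrib_left)
    then show ?thesis using False by (simp add: z_def)
  qed
  have u'wk: "(\<Sum>s\<in>S. u' s * cnj (w k s)) = 0"
  proof -
    have "(\<Sum>s\<in>S. u' s * cnj (w k s))
        = (\<Sum>s\<in>S. (\<Sum>a<k. cnj (d a) * (u' s * cnj (w a s))) + u' s * cnj (p s))"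
      by (intro sum.cong refl) (simp add: wk algebra_simps sum_distrib_left)
    also have "\<dots> = (\<Sum>a<k. cnj (d a) * (\<Sum>s\<in>S. u' s * cnj (w a s))) + (\<Sum>s\<in>S. u' s * cnj (p s))"
      by (simp add: sum.distrib sum_distrib_left) (rule sum.swap)
    finally show ?thesis using u'w u'p by simp
  qed
  have "v s = (\<Sum>a<Suc k. c' a * w a s) + u' s" if "s \<in> S" for s
  proof -
    have "(\<Sum>a<Suc k. c' a * w a s) = (\<Sum>a<k. (c a - z * d a) * w a s) + z * w k s"
      by (simp add: c'_def)
    then show ?thesis
      using that by (simp add: v wk u'_def algebra_simps sum_subtractf sum_distrib_left)
  qed
  moreover have "\<forall>a<Suc k. (\<Sum>s\<in>S. u' s * cnj (w a s)) = 0"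
    using u'w u'wk by (auto simp: less_Suc_eq)
  ultimately show ?case by blast
qed

text \<open>For any \<open>u\<close>, the sum over \<open>a\<close> of the squared moduli of the
  inner products of \<open>u\<close> with \<open>w a\<close> is determined by the outer sums, so a
  vector orthogonal to every \<open>w a\<close> is orthogonal to every \<open>v b\<close>. Applied
  to the remainder \<open>u\<close> of \<open>v b\<close> after projection, this makes
  \<open>u\<close> orthogonal to itself.\<close>

lemma span_of_equal_outer_sums:
  fixes w v :: "nat \<Rightarrow> 'a \<Rightarrow> complex"
  assumes S: "finite S" and b: "b < l"
    and eq: "\<And>s t. \<lbrakk>s \<in> S; t \<in> S\<rbrakk> \<Longrightarrow> (\<Sum>a<k. w a s * cnj (w a t)) = (\<Sum>a<l. v a s * cnj (v a t))"
  shows "\<exists>c. \<forall>s\<in>S. v b s = (\<Sum>a<k. c a * w a s)"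
proof -
  obtain c u where v: "\<And>s. s \<in> S \<Longrightarrow> v b s = (\<Sum>a<k. c a * w a s) + u s"
    and u: "\<And>a. a < k \<Longrightarrow> (\<Sum>s\<in>S. u s * cnj (w a s)) = 0"
    using orthogonal_decomposition[OF S, where v = "v b" and k = k and w = w] by metis
  have norms: "(\<Sum>a<q. (\<Sum>s\<in>S. u s * cnj (f a s)) * cnj (\<Sum>s\<in>S. u s * cnj (f a s)))
      = (\<Sum>s\<in>S. \<Sum>t\<in>S. u s * cnj (u t) * (\<Sum>a<q. f a t * cnj (f a s)))"
    for q and f :: "nat \<Rightarrow> 'a \<Rightarrow> complex"
  proof -
    have "(\<Sum>a<q. (\<Sum>s\<in>S. u s * cnj (f a s)) * cnj (\<Sum>s\<in>S. u s * cnj (f a s)))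
      = (\<Sum>a<q. \<Sum>s\<in>S. \<Sum>t\<in>S. u s * cnj (u t) * (f a t * cnj (f a s)))"
      by (simp add: sum_product mult_ac)
    also have "\<dots> = (\<Sum>s\<in>S. \<Sum>a<q. \<Sum>t\<in>S. u s * cnj (u t) * (f a t * cnj (f a s)))"
      by (rule sum.swap)
    also have "\<dots> = (\<Sum>s\<in>S. \<Sum>t\<in>S. \<Sum>a<q. u s * cnj (u t) * (f a t * cnj (f a s)))"
      by (intro sum.cong refl sum.swap)
    finally show ?thesis by (simp add: sum_distrib_left)
  qed
  have "(\<Sum>a<l. (\<Sum>s\<in>S. u s * cnj (v a s)) * cnj (\<Sum>s\<in>S. u s * cnj (v a s)))
      = (\<Sum>a<k. (\<Sum>s\<in>S. u s * cnj (w a s)) * cnj (\<Sum>s\<in>S. u s * cnj (w a s)))"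
    unfolding norms by (intro sum.cong refl) (simp add: eq)
  also have "\<dots> = 0" using u by simp
  \<comment> \<open>A vanishing sum of squared moduli makes every summand vanish, in particular the
    one at \<open>b\<close>. Inserting the decomposition of \<open>v b\<close> then leaves only the
    squared norm of \<open>u\<close>.\<close>
  finally have "(\<Sum>s\<in>S. u s * cnj (v b s)) = 0"
    using b by (subst (asm) sum_mult_cnj_eq_0_iff) auto
  also have "(\<Sum>s\<in>S. u s * cnj (v b s))
      = (\<Sum>s\<in>S. (\<Sum>a<k. cnj (c a) * (u s * cnj (w a s))) + u s * cnj (u s))"
    by (intro sum.cong refl) (simp add: v algebra_simps sum_distrib_left)
  also have "\<dots> = (\<Sum>a<k. cnj (c a) * (\<Sum>s\<in>S. u s * cnj (w a s))) + (\<Sum>s\<in>S. u s * cnj (u s))"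
    by (simp add: sum.distrib sum_distrib_left) (rule sum.swap)
  finally have "\<forall>s\<in>S. u s = 0" using u S by (simp add: sum_mult_cnj_eq_0_iff)
  then show ?thesis using v by auto
qed

text \<open>The value of \<open>\<Phi>\<close> on a matrix unit \<open>E u w\<close> is an outer sum
  of Kraus entries. Two representations of the same map therefore have equal outer sums, once
  matrices are read as functions on index pairs.\<close>

lemma kraus_span:
  assumes B: "kraus_representation n m \<Phi> k B" and C: "kraus_representation n m \<Phi> s C" and c: "c < s"
  shows "\<exists>d. \<forall>i<m. \<forall>u<n. C c $$ (i, u) = (\<Sum>a<k. d a * B a $$ (i, u))"
proof -
  define E :: "nat \<Rightarrow> nat \<Rightarrow> complex mat"
    where "E u w = mat n n (\<lambda>(e, f). if e = u \<and> f = w then 1 else 0)" for u w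
  have E: "E u w \<in> carrier_mat n n" for u w by (simp add: E_def)
  have outer: "(\<Sum>a<q. D a $$ (i, u) * cnj (D a $$ (j, w))) = \<Phi> (E u w) $$ (i, j)"
    if D: "kraus_representation n m \<Phi> q D" and ij: "i < m" "j < m" and uw: "u < n" "w < n"
    for q D i j u w
  proof -
    have "\<Phi> (E u w) $$ (i, j)
        = (\<Sum>a<q. \<Sum>e<n. \<Sum>f<n. D a $$ (i, e) * E u w $$ (e, f) * cnj (D a $$ (j, f)))"
      by (rule index_kraus[OF D E ij])
    also have "\<dots> = (\<Sum>a<q. \<Sum>e<n. \<Sum>f<n. if e = u then
        if f = w then D a $$ (i, e) * cnj (D a $$ (j, f)) else 0 else 0)"
      by (intro sum.cong refl) (simp add: E_def)
    also have "\<dots> = (\<Sum>a<q. \<Sum>e<n. if e = u then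
        \<Sum>f<n. if f = w then D a $$ (i, e) * cnj (D a $$ (j, f)) else 0 else 0)"
      by (intro sum.cong refl) auto
    finally show ?thesis using uw by simp
  qed
  have "\<exists>d. \<forall>p\<in>{..<m} \<times> {..<n}. C c $$ p = (\<Sum>a<k. d a * B a $$ p)"
  proof (rule span_of_equal_outer_sums[where v = "\<lambda>a p. C a $$ p" and w = "\<lambda>a p. B a $$ p", OF _ c])
    fix p q assume "p \<in> {..<m} \<times> {..<n}" "q \<in> {..<m} \<times> {..<n}"
    then show "(\<Sum>a<k. B a $$ p * cnj (B a $$ q)) = (\<Sum>a<s. C a $$ p * cnj (C a $$ q))"
      by (cases p, cases q) (simp add: outer[OF B] outer[OF C])
  qed simp
  then show ?thesis by auto
qed

section \<open>An informationally complete POVM\<close>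

lemma sum_cnj_self_nonneg: "0 \<le> (z::complex) * cnj z"
  using conjugate_square_positive[of z] by simp

text \<open>
  The vectors \<open>e\<^sub>k + \<i>\<^sup>t e\<^sub>l\<close> determine a matrix by polarization.  Letting \<open>t\<close> run over all four
  values makes the cross terms cancel, so their projections sum to exactly \<open>8m\<close> times the identity.
\<close>

lemma informationally_complete_povm:
  obtains N F where "povm m N F"
    and "\<And>Z W. \<lbrakk>Z \<in> carrier_mat m m; W \<in> carrier_mat m m;
           \<And>j. j < N \<Longrightarrow> hs_inner Z (F j) = hs_inner W (F j)\<rbrakk> \<Longrightarrow> Z = W"
proof -
  \<comment> \<open>Triples with \<open>k = l\<close> are kept: they give multiples of a basis
    vector, and the zero vector at \<open>t = 2\<close>, and they let both indices run freely in the
    sum.\<close>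
  define S :: "(nat \<times> nat \<times> nat) set" where "S = {..<m} \<times> {..<m} \<times> {..<4}"
  define v where "v = (\<lambda>(k::nat, l::nat, t::nat). vec m (\<lambda>i. (if i = k then 1 else 0) + \<i> ^ t * (if i = l then 1 else 0)))"
  define G where "G q = complex_of_real (1 / (8 * real m)) \<cdot>\<^sub>m rank_one_proj (v q)" for q
  define N where "N = card S"
  obtain h where h: "bij_betw h {..<N} S"
    using ex_bij_betw_nat_finite[of S] by (auto simp: S_def N_def lessThan_atLeast0)
  have vc: "v q \<in> carrier_vec m" for q by (simp add: v_def split: prod.split)
  have Gc: "G q \<in> carrier_mat m m" for q using vc by (simp add: G_def)
  have G: "G q $$ (i, j) = complex_of_real (1 / (8 * real m)) * (v q $ i * cnj (v q $ j))"
    if "i < m" "j < m" for q i j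
    using that vc[of q] by (simp add: G_def rank_one_proj_def)
  have "psd m (G e)" for e
    unfolding psd_def
  proof (intro conjI ballI Gc)
    fix x :: "complex vec" assume x: "x \<in> carrier_vec m"
    \<comment> \<open>\<open>z\<close> is the inner product of \<open>v e\<close> with
      \<open>x\<close>, so the quadratic form of the scaled projection is a nonnegative multiple of
      its squared modulus.\<close>
    define z where "z = (\<Sum>p<m. v e $ p * cnj (x $ p))"
    have "(G e *\<^sub>v x) \<bullet>c x = complex_of_real (1 / (8 * real m)) * (z * cnj z)"
    proof -
      have "z * cnj z = (\<Sum>p<m. \<Sum>q<m. (v e $ p * cnj (x $ p)) * (cnj (v e $ q) * x $ q))"
        unfolding z_def cnj_sum sum_product by simp
      then show ?thesis
        unfolding quadratic_form_sum[OF Gc x]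
        by (simp only: sum_distrib_left) (intro sum.cong refl, simp add: G)
    qed
    moreover have "0 \<le> complex_of_real (1 / (8 * real m))" by (simp add: less_eq_complex_def)
    ultimately show "0 \<le> (G e *\<^sub>v x) \<bullet>c x"
      using sum_cnj_self_nonneg[of z] by (metis mult_nonneg_nonneg)
  qed
  moreover have "msum m m (\<lambda>j. G (h j)) N = 1\<^sub>m m"
  proof (rule eq_matI)
    fix i j assume "i < dim_row (1\<^sub>m m :: complex mat)" "j < dim_col (1\<^sub>m m :: complex mat)"
    then have ij: "i < m" "j < m" by auto
    define \<delta> where "\<delta> a b = (if a = b then 1 else 0 :: complex)" for a b :: nat
    have \<delta>2: "\<delta> a c * \<delta> b c = (if c = a then \<delta> a b else 0)" for a b c by (auto simp: \<delta>_def)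
    have sum_roots: "(\<Sum>t<4. (a + \<i> ^ t * b) * cnj (c + \<i> ^ t * d)) = 4 * (a * cnj c + b * cnj d)"
      for a b c d
      by (simp add: eval_nat_numeral algebra_simps)
    have "msum m m (\<lambda>j. G (h j)) N $$ (i, j) = (\<Sum>a<N. G (h a) $$ (i, j))"
      using ij by (simp add: msum_def)
    also have "\<dots> = (\<Sum>q\<in>S. G q $$ (i, j))"
      by (rule sum.reindex_bij_betw[OF h])
    also have "\<dots> = (\<Sum>k<m. \<Sum>l<m. \<Sum>t<4. G (k, l, t) $$ (i, j))"
      by (simp add: S_def sum.cartesian_product)
    also have "\<dots> = (\<Sum>k<m. \<Sum>l<m. complex_of_real (1 / (2 * real m)) * (\<delta> i k * \<delta> j k + \<delta> i l * \<delta> j l))"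
    proof (intro sum.cong refl)
      fix k l
      have "(\<Sum>t<4. G (k, l, t) $$ (i, j)) = complex_of_real (1 / (8 * real m)) *
          (\<Sum>t<4. (\<delta> i k + \<i> ^ t * \<delta> i l) * cnj (\<delta> j k + \<i> ^ t * \<delta> j l))"
        unfolding sum_distrib_left using ij by (intro sum.cong refl) (simp add: G v_def \<delta>_def)
      also have "\<dots> = complex_of_real (1 / (8 * real m)) * (4 * (\<delta> i k * \<delta> j k + \<delta> i l * \<delta> j l))"
        by (simp only: sum_roots) (simp add: \<delta>_def)
      also have "\<dots> = complex_of_real (1 / (2 * real m)) * (\<delta> i k * \<delta> j k + \<delta> i l * \<delta> j l)"
        using ij by (simp add: field_simps)
      finally show "(\<Sum>t<4. G (k, l, t) $$ (i, j)) =
          complex_of_real (1 / (2 * real m)) * (\<delta> i k * \<delta> j k + \<delta> i l * \<delta> j l)" .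
    qed
    also have "\<dots> = complex_of_real (1 / (2 * real m)) * (\<Sum>k<m. \<Sum>l<m. \<delta> i k * \<delta> j k + \<delta> i l * \<delta> j l)"
      by (simp only: sum_distrib_left)
    also have "(\<Sum>k<m. \<Sum>l<m. \<delta> i k * \<delta> j k + \<delta> i l * \<delta> j l)
        = (\<Sum>k<m. \<Sum>l<m. (if k = i then \<delta> i j else 0) + (if l = i then \<delta> i j else 0))"
      by (intro sum.cong refl) (simp only: \<delta>2)
    also have "\<dots> = 2 * of_nat m * \<delta> i j"
      using ij by (simp add: sum.distrib flip: sum_distrib_left)
    also have "complex_of_real (1 / (2 * real m)) * (2 * of_nat m * \<delta> i j) = 1\<^sub>m m $$ (i, j)"
      using ij by (simp add: \<delta>_def)
    finally show "msum m m (\<lambda>j. G (h j)) N $$ (i, j) = 1\<^sub>m m $$ (i, j)" .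
  qed (auto simp: msum_def)
  ultimately have "povm m N (\<lambda>j. G (h j))" by (simp add: povm_def)
  moreover have "Z = W" if Z: "Z \<in> carrier_mat m m" and W: "W \<in> carrier_mat m m"
    and eq: "\<And>j. j < N \<Longrightarrow> hs_inner Z (G (h j)) = hs_inner W (G (h j))" for Z W
  proof (rule eq_matI)
    fix k l assume "k < dim_row W" "l < dim_col W"
    then have kl: "k < m" "l < m" using W by auto
    \<comment> \<open>Up to the scaling this is the quadratic form of \<open>X\<close> at
      \<open>v (k, l, t)\<close>, expanded into the four entries of \<open>X\<close> that it
      sees.\<close>
    have form: "hs_inner X (G (k, l, t)) = complex_of_real (1 / (8 * real m)) *
        (X $$ (k, k) + \<i> ^ t * X $$ (k, l) + cnj (\<i> ^ t) * (X $$ (l, k) + \<i> ^ t * X $$ (l, l)))"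
      if X: "X \<in> carrier_mat m m" for X t
    proof -
      have lin: "(\<Sum>i<m. f i * ((if i = k then 1 else 0) + e * (if i = l then 1 else 0))) = f k + e * f l"
        for f :: "nat \<Rightarrow> complex" and e
      proof -
        have "(\<Sum>i<m. f i * ((if i = k then 1 else 0) + e * (if i = l then 1 else 0)))
            = (\<Sum>i<m. (if i = k then f i else 0) + (if i = l then e * f i else 0))"
          by (intro sum.cong refl) (simp add: algebra_simps)
        then show ?thesis using kl by (simp add: sum.distrib)
      qed
      have "hs_inner X (G (k, l, t)) = complex_of_real (1 / (8 * real m)) *
          (\<Sum>i<m. (\<Sum>j<m. X $$ (i, j) * ((if j = k then 1 else 0) + \<i> ^ t * (if j = l then 1 else 0)))
            * ((if i = k then 1 else 0) + cnj (\<i> ^ t) * (if i = l then 1 else 0)))"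
        unfolding hs_inner_sum[OF X Gc] sum_distrib_left sum_distrib_right
        by (intro sum.cong refl) (simp add: G v_def mult_ac)
      then show ?thesis by (simp only: lin)
    qed
    \<comment> \<open>The weights are the inverses of the powers \<open>\<i> ^ t\<close>. Summing
      over \<open>t\<close> therefore isolates the entry that \<open>form\<close> multiplies by
      \<open>\<i> ^ t\<close>; it is counted four times, which turns 1/8 into 1/2.\<close>
    have pol: "complex_of_real (1 / (2 * real m)) * X $$ (k, l)
        = hs_inner X (G (k, l, 0)) - \<i> * hs_inner X (G (k, l, 1))
          - hs_inner X (G (k, l, 2)) + \<i> * hs_inner X (G (k, l, 3))"
      if X: "X \<in> carrier_mat m m" for X
    proof -
      have pow: "\<i> ^ 0 = 1" "\<i> ^ 1 = \<i>" "\<i> ^ 2 = -1" "\<i> ^ 3 = - \<i>"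
        by (simp_all add: power3_eq_cube)
      have pol: "c * (4 * b) = c * (a + 1 * b + cnj 1 * (d + 1 * e))
          - \<i> * (c * (a + \<i> * b + cnj \<i> * (d + \<i> * e)))
          - c * (a + (- 1) * b + cnj (- 1) * (d + (- 1) * e))
          + \<i> * (c * (a + (- \<i>) * b + cnj (- \<i>) * (d + (- \<i>) * e)))" for a b c d e
        by (simp add: algebra_simps)
      show ?thesis
        unfolding form[OF X] pow pol[symmetric] using kl by (simp add: field_simps)
    qed
    have "hs_inner Z (G (k, l, t)) = hs_inner W (G (k, l, t))" if "t < 4" for t
    proof -
      have "(k, l, t) \<in> h ` {..<N}" using kl that h by (simp add: S_def bij_betw_def)
      then show ?thesis using eq by auto
    qed
    then have "complex_of_real (1 / (2 * real m)) * Z $$ (k, l) = complex_of_real (1 / (2 * real m)) * W $$ (k, l)"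
      unfolding pol[OF Z] pol[OF W] by simp
    then show "Z $$ (k, l) = W $$ (k, l)" using kl by simp
  qed (use Z W in auto)
  ultimately show ?thesis by (rule that)
qed

section \<open>Linearity and complete positivity of Kraus maps\<close>

text \<open>Follows the indexing of \<open>ampliation\<close>: \<open>a\<close> numbers the block
  and \<open>i\<close> the position inside it.\<close>

lemma sum_div_mod_split:
  fixes f :: "nat \<Rightarrow> 'a::comm_monoid_add"
  shows "(\<Sum>p<k * m. f p) = (\<Sum>a<k. \<Sum>i<m. f (a * m + i))"
proof -
  have "sum f {a * m..<a * m + m} = (\<Sum>i<m. f (a * m + i))" for a
    using sum.shift_bounds_nat_ivl[of f 0 "a * m" m] by (simp add: lessThan_atLeast0 add.commute)
  then show ?thesis by (simp flip: sum.nat_group)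
qed

lemma block_index_less: "\<lbrakk>a < k; i < m\<rbrakk> \<Longrightarrow> a * m + i < k * (m::nat)"
  using mult_le_mono1[of "Suc a" k m] by simp

text \<open>Ampliation sends \<open>X\<close> to the sum over \<open>c\<close> of the conjugates of
  \<open>X\<close> by the identity tensored with \<open>C c\<close>. Its form at \<open>v\<close> is
  thus the sum of the forms of \<open>X\<close> at the vectors \<open>w c\<close>, which arise from
  \<open>v\<close> by applying the adjoint of \<open>C c\<close> in each block.\<close>

lemma kraus_completely_positive:
  assumes K: "kraus_representation n m \<Phi> s C"
  shows "completely_positive n m \<Phi>"
  unfolding completely_positive_def psd_def[of "_ * m"]
proof (intro allI impI conjI ballI)
  fix k X assume X: "psd (k * n) X"
  show M: "ampliation k n m \<Phi> X \<in> carrier_mat (k * m) (k * m)" by (simp add: ampliation_def)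
  fix v :: "complex vec" assume v: "v \<in> carrier_vec (k * m)"
  define w where "w c = vec (k * n) (\<lambda>p. \<Sum>i<m. cnj (C c $$ (i, p mod n)) * v $ (p div n * m + i))" for c
  have w: "w c \<in> carrier_vec (k * n)" for c by (simp add: w_def)
  have wi: "w c $ (a * n + u) = (\<Sum>i<m. cnj (C c $$ (i, u)) * v $ (a * m + i))" if "a < k" "u < n" for c a u
    using that block_index_less[OF that] by (simp add: w_def)
  let ?f = "\<lambda>c a u b t i j. X $$ (a * n + u, b * n + t) * (C c $$ (i, u) * (cnj (C c $$ (j, t))
      * (v $ (b * m + j) * cnj (v $ (a * m + i)))))"
  have "(ampliation k n m \<Phi> X *\<^sub>v v) \<bullet>c v
      = (\<Sum>a<k. \<Sum>i<m. \<Sum>b<k. \<Sum>j<m. \<Phi> (block n X a b) $$ (i, j) * v $ (b * m + j) * cnj (v $ (a * m + i)))"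
    unfolding quadratic_form_sum[OF M v] sum_div_mod_split
    by (intro sum.cong refl) (simp add: ampliation_def block_index_less)
  also have "\<dots> = (\<Sum>a<k. \<Sum>i<m. \<Sum>b<k. \<Sum>j<m. \<Sum>c<s. \<Sum>u<n. \<Sum>t<n. ?f c a u b t i j)"
  proof (intro sum.cong refl)
    fix a i b j assume "i \<in> {..<m}" "j \<in> {..<m}"
    then have "\<Phi> (block n X a b) $$ (i, j)
        = (\<Sum>c<s. \<Sum>u<n. \<Sum>t<n. C c $$ (i, u) * block n X a b $$ (u, t) * cnj (C c $$ (j, t)))"
      by (intro index_kraus[OF K]) (auto simp: block_def)
    also have "\<dots> = (\<Sum>c<s. \<Sum>u<n. \<Sum>t<n. C c $$ (i, u) * X $$ (a * n + u, b * n + t) * cnj (C c $$ (j, t)))"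
      by (intro sum.cong refl) (simp add: block_def)
    finally show "\<Phi> (block n X a b) $$ (i, j) * v $ (b * m + j) * cnj (v $ (a * m + i))
        = (\<Sum>c<s. \<Sum>u<n. \<Sum>t<n. ?f c a u b t i j)"
      by (simp only: sum_distrib_left sum_distrib_right mult_ac)
  qed
  also have "\<dots> = (\<Sum>(a, i, b, j, c, u, t)\<in>{..<k} \<times> {..<m} \<times> {..<k} \<times> {..<m} \<times> {..<s} \<times> {..<n} \<times> {..<n}.
      ?f c a u b t i j)"
    by (simp only: sum.cartesian_product)
  \<comment> \<open>The output indices \<open>j\<close> and \<open>i\<close> go innermost, where
    their sums assemble the entries of \<open>w c\<close> and of its conjugate.\<close>
  also have "\<dots> = (\<Sum>(c, a, u, b, t, j, i)\<in>{..<s} \<times> {..<k} \<times> {..<n} \<times> {..<k} \<times> {..<n} \<times> {..<m} \<times> {..<m}.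
      ?f c a u b t i j)"
    by (rule sum.reindex_bij_witness[where i = "\<lambda>(c, a, u, b, t, j, i). (a, i, b, j, c, u, t)"
          and j = "\<lambda>(a, i, b, j, c, u, t). (c, a, u, b, t, j, i)"]) auto
  also have "\<dots> = (\<Sum>c<s. \<Sum>a<k. \<Sum>u<n. \<Sum>b<k. \<Sum>t<n. \<Sum>j<m. \<Sum>i<m. ?f c a u b t i j)"
    by (simp only: sum.cartesian_product)
  also have "\<dots> = (\<Sum>c<s. \<Sum>a<k. \<Sum>u<n. \<Sum>b<k. \<Sum>t<n.
      X $$ (a * n + u, b * n + t) * w c $ (b * n + t) * cnj (w c $ (a * n + u)))"
  proof (intro sum.cong refl)
    fix c a u b t assume *: "a \<in> {..<k}" "u \<in> {..<n}" "b \<in> {..<k}" "t \<in> {..<n}"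
    then have eq: "w c $ (b * n + t) = (\<Sum>j<m. cnj (C c $$ (j, t)) * v $ (b * m + j))"
      "cnj (w c $ (a * n + u)) = (\<Sum>i<m. C c $$ (i, u) * cnj (v $ (a * m + i)))"
      by (simp_all add: wi)
    show "(\<Sum>j<m. \<Sum>i<m. ?f c a u b t i j)
        = X $$ (a * n + u, b * n + t) * w c $ (b * n + t) * cnj (w c $ (a * n + u))"
      unfolding eq mult.assoc sum_product by (simp only: sum_distrib_left mult_ac)
  qed
  also have "\<dots> = (\<Sum>c<s. (X *\<^sub>v w c) \<bullet>c w c)"
    using X by (intro sum.cong refl, subst quadratic_form_sum[OF _ w])
      (simp_all add: psd_def sum_div_mod_split)
  finally show "0 \<le> (ampliation k n m \<Phi> X *\<^sub>v v) \<bullet>c v"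
    using X w by (simp add: psd_def sum_nonneg)
qed

lemma kraus_linear_super:
  assumes K: "kraus_representation n m \<Phi> s C"
  shows "linear_super n m \<Phi>"
proof -
  have "\<Phi> (X + Y) = \<Phi> X + \<Phi> Y" if X: "X \<in> carrier_mat n n" and Y: "Y \<in> carrier_mat n n" for X Y
  proof (rule eq_matI)
    fix i j assume "i < dim_row (\<Phi> X + \<Phi> Y)" "j < dim_col (\<Phi> X + \<Phi> Y)"
    then have ij: "i < m" "j < m" using kraus_image_carrier[OF K Y] by auto
    have XY: "X + Y \<in> carrier_mat n n" using X Y by simp
    have "\<Phi> (X + Y) $$ (i, j) = (\<Sum>c<s. \<Sum>u<n. \<Sum>w<n.
        C c $$ (i, u) * X $$ (u, w) * cnj (C c $$ (j, w)) + C c $$ (i, u) * Y $$ (u, w) * cnj (C c $$ (j, w)))"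
      unfolding index_kraus[OF K XY ij]
      using X Y by (intro sum.cong refl) (simp add: algebra_simps)
    then show "\<Phi> (X + Y) $$ (i, j) = (\<Phi> X + \<Phi> Y) $$ (i, j)"
      using ij kraus_image_carrier[OF K X] kraus_image_carrier[OF K Y]
      by (simp add: index_kraus[OF K X ij] index_kraus[OF K Y ij] sum.distrib)
  qed (use X Y kraus_image_carrier[OF K, of "X + Y"] kraus_image_carrier[OF K Y] in auto)
  moreover have "\<Phi> (c \<cdot>\<^sub>m X) = c \<cdot>\<^sub>m \<Phi> X" if X: "X \<in> carrier_mat n n" for c X
  proof (rule eq_matI)
    fix i j assume "i < dim_row (c \<cdot>\<^sub>m \<Phi> X)" "j < dim_col (c \<cdot>\<^sub>m \<Phi> X)"
    then have ij: "i < m" "j < m" using kraus_image_carrier[OF K X] by auto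
    have cX: "c \<cdot>\<^sub>m X \<in> carrier_mat n n" using X by simp
    have "\<Phi> (c \<cdot>\<^sub>m X) $$ (i, j) = (\<Sum>a<s. \<Sum>u<n. \<Sum>w<n.
        c * (C a $$ (i, u) * X $$ (u, w) * cnj (C a $$ (j, w))))"
      unfolding index_kraus[OF K cX ij]
      using X by (intro sum.cong refl) (simp add: algebra_simps)
    then show "\<Phi> (c \<cdot>\<^sub>m X) $$ (i, j) = (c \<cdot>\<^sub>m \<Phi> X) $$ (i, j)"
      using ij kraus_image_carrier[OF K X]
      by (simp add: index_kraus[OF K X ij] sum_distrib_left)
  qed (use X kraus_image_carrier[OF K, of "c \<cdot>\<^sub>m X"] kraus_image_carrier[OF K X] in auto)
  ultimately show ?thesis using kraus_image_carrier[OF K] by (simp add: linear_super_def)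
qed

section \<open>The complementary channel and its Kraus operators\<close>

text \<open>The operators \<open>B\<^sub>a\<close> with \<open>B\<^sub>a x = ((A\<^sub>i x)\<^sub>a)\<^sub>i\<close>.\<close>

definition complementary_kraus :: "nat \<Rightarrow> nat \<Rightarrow> (nat \<Rightarrow> complex mat) \<Rightarrow> nat \<Rightarrow> complex mat" where
  "complementary_kraus n r A a = mat r n (\<lambda>(i, u). A i $$ (a, u))"

lemma trace_sandwich:
  fixes A B X :: "complex mat"
  assumes "A \<in> carrier_mat m n" "B \<in> carrier_mat m n" "X \<in> carrier_mat n n"
  shows "trace (A * X * mat_adjoint B)
    = (\<Sum>a<m. \<Sum>u<n. \<Sum>w<n. A $$ (a, u) * X $$ (u, w) * cnj (B $$ (a, w)))"
proof -
  have "trace (A * X * mat_adjoint B) = (\<Sum>a<m. (A * X * mat_adjoint B) $$ (a, a))"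
    using assms by (simp add: trace_def del: index_mult_mat(1))
  then show ?thesis by (simp add: index_sandwich[OF assms] del: index_mult_mat(1))
qed

text \<open>Row \<open>i\<close> of the operator with index \<open>a\<close> is row \<open>a\<close>
  of \<open>A i\<close>. Expanding the trace of \<open>A i * \<rho> * mat_adjoint (A j)\<close>
  along the diagonal index \<open>a\<close> therefore already produces the Kraus sum at entry
  \<open>(i, j)\<close>.\<close>

lemma kraus_complementary:
  assumes K: "kraus_representation n m \<Phi> r A"
  shows "kraus_representation n r (complementary_channel r A) m (complementary_kraus n r A)"
  unfolding kraus_representation_def
proof (intro conjI allI impI ballI)
  have B: "complementary_kraus n r A a \<in> carrier_mat r n" for a by (simp add: complementary_kraus_def)
  show "complementary_kraus n r A a \<in> carrier_mat r n" for a by (rule B)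
  fix \<rho> :: "complex mat" assume \<rho>: "\<rho> \<in> carrier_mat n n"
  show "complementary_channel r A \<rho>
      = msum r r (\<lambda>i. complementary_kraus n r A i * \<rho> * mat_adjoint (complementary_kraus n r A i)) m"
  proof (rule eq_matI)
    fix i j assume "i < dim_row (msum r r (\<lambda>i. complementary_kraus n r A i * \<rho> * mat_adjoint (complementary_kraus n r A i)) m)"
      "j < dim_col (msum r r (\<lambda>i. complementary_kraus n r A i * \<rho> * mat_adjoint (complementary_kraus n r A i)) m)"
    then have ij: "i < r" "j < r" by (auto simp: msum_def)
    have "complementary_channel r A \<rho> $$ (i, j)
        = (\<Sum>a<m. \<Sum>u<n. \<Sum>w<n. A i $$ (a, u) * \<rho> $$ (u, w) * cnj (A j $$ (a, w)))"
      using ij by (simp add: complementary_channel_def trace_sandwich[OF kraus_carrier[OF K] kraus_carrier[OF K] \<rho>])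
    also have "\<dots> = (\<Sum>a<m. (complementary_kraus n r A a * \<rho> * mat_adjoint (complementary_kraus n r A a)) $$ (i, j))"
      using ij by (intro sum.cong refl, subst index_sandwich[OF B B \<rho>]) (auto simp: complementary_kraus_def)
    finally show "complementary_channel r A \<rho> $$ (i, j)
        = msum r r (\<lambda>i. complementary_kraus n r A i * \<rho> * mat_adjoint (complementary_kraus n r A i)) m $$ (i, j)"
      using ij by (simp add: msum_def)
  qed (auto simp: complementary_channel_def msum_def)
qed

text \<open>Both sides add up the diagonal entries of all
  \<open>A i * X * mat_adjoint (A i)\<close>, only in a different order. Trace preservation passes
  from \<open>\<Phi>\<close> to the complementary channel this way.\<close>

lemma trace_complementary_channel:
  assumes K: "kraus_representation n m \<Phi> r A" and X: "X \<in> carrier_mat n n"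
  shows "trace (complementary_channel r A X) = trace (\<Phi> X)"
proof -
  have "trace (complementary_channel r A X) = (\<Sum>i<r. trace (A i * X * mat_adjoint (A i)))"
    unfolding trace_def[of "complementary_channel r A X"] by (simp add: complementary_channel_def)
  also have "\<dots> = (\<Sum>i<r. \<Sum>a<m. \<Sum>u<n. \<Sum>w<n. A i $$ (a, u) * X $$ (u, w) * cnj (A i $$ (a, w)))"
    by (intro sum.cong refl trace_sandwich X kraus_carrier[OF K]) simp_all
  also have "\<dots> = (\<Sum>a<m. \<Phi> X $$ (a, a))"
    by (simp add: index_kraus[OF K X]) (rule sum.swap)
  also have "\<dots> = trace (\<Phi> X)"
    using kraus_image_carrier[OF K X] by (simp add: trace_def)
  finally show ?thesis .
qed

text \<open>Needed because \<open>psic_channel\<close> asks for a quantum channel besides a suitable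
  Kraus family.\<close>

lemma quantum_channel_complementary:
  assumes "quantum_channel n m \<Phi>" and K: "kraus_representation n m \<Phi> r A"
  shows "quantum_channel n r (complementary_channel r A)"
  using assms(1) kraus_linear_super[OF kraus_complementary[OF K]]
    kraus_completely_positive[OF kraus_complementary[OF K]]
    trace_complementary_channel[OF K]
  by (simp add: quantum_channel_def)

lemma quadratic_form_adjoint_mult:
  fixes A B :: "complex mat"
  assumes A: "A \<in> carrier_mat m n" and B: "B \<in> carrier_mat m n" and x: "x \<in> carrier_vec n"
  shows "((mat_adjoint B * A) *\<^sub>v x) \<bullet>c x = (\<Sum>i<m. (A *\<^sub>v x) $ i * cnj ((B *\<^sub>v x) $ i))"
proof -
  have Bt: "mat_adjoint B \<in> carrier_mat n m" using B by (auto intro: carrier_matI)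
  have Ax: "A *\<^sub>v x \<in> carrier_vec m" using A x by auto
  have "((mat_adjoint B * A) *\<^sub>v x) \<bullet>c x = (\<Sum>u<n. (\<Sum>i<m. cnj (B $$ (i, u)) * (A *\<^sub>v x) $ i) * cnj (x $ u))"
    unfolding assoc_mult_mat_vec[OF Bt A x] cscalar_prod_sum[OF x]
  proof (intro sum.cong refl)
    fix u assume u: "u \<in> {..<n}"
    then have "(mat_adjoint B *\<^sub>v (A *\<^sub>v x)) $ u = (\<Sum>i<m. mat_adjoint B $$ (u, i) * (A *\<^sub>v x) $ i)"
      by (intro index_mult_mat_vec_sum[OF Bt Ax]) simp
    also have "\<dots> = (\<Sum>i<m. cnj (B $$ (i, u)) * (A *\<^sub>v x) $ i)"
      using u B by (intro sum.cong refl) simp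
    finally show "(mat_adjoint B *\<^sub>v (A *\<^sub>v x)) $ u * cnj (x $ u)
        = (\<Sum>i<m. cnj (B $$ (i, u)) * (A *\<^sub>v x) $ i) * cnj (x $ u)" by simp
  qed
  also have "\<dots> = (\<Sum>i<m. \<Sum>u<n. (A *\<^sub>v x) $ i * cnj (B $$ (i, u) * x $ u))"
    unfolding sum_distrib_right by (subst sum.swap) (intro sum.cong refl, simp)
  also have "\<dots> = (\<Sum>i<m. (A *\<^sub>v x) $ i * cnj (\<Sum>u<n. B $$ (i, u) * x $ u))"
    by (simp only: sum_distrib_left cnj_sum)
  also have "\<dots> = (\<Sum>i<m. (A *\<^sub>v x) $ i * cnj ((B *\<^sub>v x) $ i))"
    by (intro sum.cong refl) (simp only: index_mult_mat_vec_sum[OF B x] lessThan_iff)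
  finally show ?thesis .
qed

section \<open>Both properties in terms of the outputs on pure states\<close>

text \<open>Equal outputs give equal values for every POVM, whereas an informationally complete POVM
  recovers the whole output from its values. This removes the POVM from the problem.\<close>

lemma phase_retrievable_iff_inj_pure:
  assumes K: "kraus_representation n m \<Phi> r A"
  shows "phase_retrievable n m \<Phi> \<longleftrightarrow>
    (\<forall>x y. unit_vector n x \<longrightarrow> unit_vector n y \<longrightarrow>
       \<Phi> (rank_one_proj x) = \<Phi> (rank_one_proj y) \<longrightarrow> rank_one_proj x = rank_one_proj y)"
    (is "_ \<longleftrightarrow> ?inj")
proof
  have unit: "x \<in> carrier_vec n" if "unit_vector n x" for x
    using that by (simp add: unit_vector_def)
  show ?inj if pr: "phase_retrievable n m \<Phi>"
  proof (intro allI impI)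
    fix x y assume x: "unit_vector n x" and y: "unit_vector n y"
      and eq: "\<Phi> (rank_one_proj x) = \<Phi> (rank_one_proj y)"
    obtain N F where "povm m N F" and F: "(\<forall>j<N. trace (rank_one_proj x * hs_adjoint n m \<Phi> (F j))
        = trace (rank_one_proj y * hs_adjoint n m \<Phi> (F j))) \<longrightarrow> rank_one_proj x = rank_one_proj y"
      using pr x y unfolding phase_retrievable_def by blast
    then have "F j \<in> carrier_mat m m" if "j < N" for j
      using that by (simp add: povm_def psd_def)
    then show "rank_one_proj x = rank_one_proj y"
      using F by (simp add: trace_hs_adjoint[OF K] unit x y eq)
  qed
  show "phase_retrievable n m \<Phi>" if inj: ?inj
  proof -
    obtain N F where povm: "povm m N F"
      and F: "\<And>Z W. \<lbrakk>Z \<in> carrier_mat m m; W \<in> carrier_mat m m;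
           \<And>j. j < N \<Longrightarrow> hs_inner Z (F j) = hs_inner W (F j)\<rbrakk> \<Longrightarrow> Z = W"
      using informationally_complete_povm[of m] by metis
    have Fc: "F j \<in> carrier_mat m m" if "j < N" for j
      using povm that by (simp add: povm_def psd_def)
    show ?thesis
      unfolding phase_retrievable_def
    proof (intro exI[of _ N] exI[of _ F] conjI povm allI impI)
      fix x y assume x: "unit_vector n x" and y: "unit_vector n y"
        and eq: "\<forall>j<N. trace (rank_one_proj x * hs_adjoint n m \<Phi> (F j))
                     = trace (rank_one_proj y * hs_adjoint n m \<Phi> (F j))"
      have "\<Phi> (rank_one_proj x) = \<Phi> (rank_one_proj y)"
      proof (rule F)
        fix j assume "j < N"
        then show "hs_inner (\<Phi> (rank_one_proj x)) (F j) = hs_inner (\<Phi> (rank_one_proj y)) (F j)"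
          using eq by (simp add: trace_hs_adjoint[OF K Fc] unit x y)
      qed (use x y unit kraus_image_carrier[OF K] in auto)
      then show "rank_one_proj x = rank_one_proj y" using inj x y by blast
    qed
  qed
qed

text \<open>Exchanging the indices gives \<open>(A i *\<^sub>v x) $ a\<close> and
  \<open>(A i *\<^sub>v x) $ b\<close> as the factors, and summing their products over
  \<open>i\<close> is the Kraus formula for the output entry.\<close>

lemma complementary_kraus_quadratic_form:
  assumes K: "kraus_representation n m \<Phi> r A" and x: "x \<in> carrier_vec n" and ab: "a < m" "b < m"
  shows "(\<Sum>i<r. (complementary_kraus n r A a *\<^sub>v x) $ i * cnj ((complementary_kraus n r A b *\<^sub>v x) $ i))
    = \<Phi> (rank_one_proj x) $$ (a, b)"
proof -
  have "(complementary_kraus n r A e *\<^sub>v x) $ i = (A i *\<^sub>v x) $ e" if "i < r" "e < m" for e i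
  proof -
    have "complementary_kraus n r A e \<in> carrier_mat r n" by (simp add: complementary_kraus_def)
    then have "(complementary_kraus n r A e *\<^sub>v x) $ i = (\<Sum>u<n. complementary_kraus n r A e $$ (i, u) * x $ u)"
      by (rule index_mult_mat_vec_sum[OF _ x that(1)])
    also have "\<dots> = (\<Sum>u<n. A i $$ (e, u) * x $ u)"
      using that by (intro sum.cong refl) (simp add: complementary_kraus_def)
    also have "\<dots> = (A i *\<^sub>v x) $ e"
      by (rule index_mult_mat_vec_sum[OF kraus_carrier[OF K that(1)] x that(2), symmetric])
    finally show ?thesis .
  qed
  then show ?thesis
    unfolding index_kraus_rank_one[OF K x ab] using ab by (intro sum.cong refl) simp
qed

text \<open>\<open>psic_channel\<close> only provides some unknown representation \<open>C\<close>.
  Expanding \<open>C c\<close> and \<open>C d\<close> in the complementary Kraus operators writes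
  the form at any \<open>z\<close> as a combination of the entries of
  \<open>\<Phi> (rank_one_proj z)\<close>, with coefficients \<open>f a * cnj (g b)\<close> that do
  not depend on \<open>z\<close>.\<close>

lemma kraus_quadratic_form_determined:
  assumes K: "kraus_representation n m \<Phi> r A"
    and C: "kraus_representation n r (complementary_channel r A) s C"
    and x: "x \<in> carrier_vec n" and y: "y \<in> carrier_vec n"
    and eq: "\<Phi> (rank_one_proj x) = \<Phi> (rank_one_proj y)" and cd: "c < s" "d < s"
  shows "((mat_adjoint (C d) * C c) *\<^sub>v x) \<bullet>c x = ((mat_adjoint (C d) * C c) *\<^sub>v y) \<bullet>c y"
proof -
  let ?B = "complementary_kraus n r A"
  have B: "?B a \<in> carrier_mat r n" for a by (simp add: complementary_kraus_def)
  note span = kraus_span[OF kraus_complementary[OF K] C]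
  obtain f where f: "\<And>i u. \<lbrakk>i < r; u < n\<rbrakk> \<Longrightarrow> C c $$ (i, u) = (\<Sum>a<m. f a * ?B a $$ (i, u))"
    using span[OF cd(1)] by auto
  obtain g where g: "\<And>i u. \<lbrakk>i < r; u < n\<rbrakk> \<Longrightarrow> C d $$ (i, u) = (\<Sum>a<m. g a * ?B a $$ (i, u))"
    using span[OF cd(2)] by auto
  have comb: "(D *\<^sub>v z) $ i = (\<Sum>a<m. h a * (?B a *\<^sub>v z) $ i)"
    if D: "D \<in> carrier_mat r n" and h: "\<And>i u. \<lbrakk>i < r; u < n\<rbrakk> \<Longrightarrow> D $$ (i, u) = (\<Sum>a<m. h a * ?B a $$ (i, u))"
      and z: "z \<in> carrier_vec n" and i: "i < r" for D h z i
  proof -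
    have "(D *\<^sub>v z) $ i = (\<Sum>u<n. \<Sum>a<m. h a * (?B a $$ (i, u) * z $ u))"
      unfolding index_mult_mat_vec_sum[OF D z i]
      using i by (intro sum.cong refl) (simp add: h sum_distrib_right mult.assoc)
    also have "\<dots> = (\<Sum>a<m. h a * (?B a *\<^sub>v z) $ i)"
      unfolding index_mult_mat_vec_sum[OF B z i] sum_distrib_left by (rule sum.swap)
    finally show ?thesis .
  qed
  have "((mat_adjoint (C d) * C c) *\<^sub>v z) \<bullet>c z
      = (\<Sum>a<m. \<Sum>b<m. f a * cnj (g b) * \<Phi> (rank_one_proj z) $$ (a, b))" if z: "z \<in> carrier_vec n" for z
  proof -
    have "((mat_adjoint (C d) * C c) *\<^sub>v z) \<bullet>c z
        = (\<Sum>i<r. (\<Sum>a<m. f a * (?B a *\<^sub>v z) $ i) * cnj (\<Sum>b<m. g b * (?B b *\<^sub>v z) $ i))"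
      unfolding quadratic_form_adjoint_mult[OF kraus_carrier[OF C cd(1)] kraus_carrier[OF C cd(2)] z]
      by (intro sum.cong refl)
        (simp only: comb[OF kraus_carrier[OF C cd(1)] f z] comb[OF kraus_carrier[OF C cd(2)] g z] lessThan_iff)
    also have "\<dots> = (\<Sum>i<r. \<Sum>a<m. \<Sum>b<m. f a * cnj (g b) * ((?B a *\<^sub>v z) $ i * cnj ((?B b *\<^sub>v z) $ i)))"
      by (simp only: cnj_sum sum_product complex_cnj_mult mult_ac)
    also have "\<dots> = (\<Sum>a<m. \<Sum>i<r. \<Sum>b<m. f a * cnj (g b) * ((?B a *\<^sub>v z) $ i * cnj ((?B b *\<^sub>v z) $ i)))"
      by (rule sum.swap)
    also have "\<dots> = (\<Sum>a<m. \<Sum>b<m. \<Sum>i<r. f a * cnj (g b) * ((?B a *\<^sub>v z) $ i * cnj ((?B b *\<^sub>v z) $ i)))"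
      by (intro sum.cong refl sum.swap)
    also have "\<dots> = (\<Sum>a<m. \<Sum>b<m. f a * cnj (g b) * \<Phi> (rank_one_proj z) $$ (a, b))"
      by (intro sum.cong refl)
        (simp only: complementary_kraus_quadratic_form[OF K z] lessThan_iff flip: sum_distrib_left)
    finally show ?thesis .
  qed
  then show ?thesis using x y eq by simp
qed

theorem theorem3:
  fixes n m r :: nat
    and \<Phi> :: "complex mat \<Rightarrow> complex mat"
    and A :: "nat \<Rightarrow> complex mat"
  assumes "quantum_channel n m \<Phi>"
    and "kraus_representation n m \<Phi> r A"
  shows "phase_retrievable n m \<Phi> \<longleftrightarrow> psic_channel n r (complementary_channel r A)"
proof -
  note K = assms(2)
  note inj_iff = phase_retrievable_iff_inj_pure[OF K]
  have unit: "x \<in> carrier_vec n" if "unit_vector n x" for x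
    using that by (simp add: unit_vector_def)
  show ?thesis
  proof
    assume pr: "phase_retrievable n m \<Phi>"
    \<comment> \<open>These \<open>m\<close> operators are the witness for the existential over
      Kraus representations; their forms are exactly the entries of the output, so equal forms mean
      equal outputs.\<close>
    let ?B = "complementary_kraus n r A"
    have B: "?B a \<in> carrier_mat r n" for a by (simp add: complementary_kraus_def)
    have "psic_family n ({..<m} \<times> {..<m}) (\<lambda>(i, j). mat_adjoint (?B j) * ?B i)"
      unfolding psic_family_def
    proof (intro allI impI)
      fix x y assume x: "unit_vector n x" and y: "unit_vector n y"
        and forms: "\<forall>\<alpha>\<in>{..<m} \<times> {..<m}. ((case \<alpha> of (i, j) \<Rightarrow> mat_adjoint (?B j) * ?B i) *\<^sub>v x) \<bullet>c x
                                = ((case \<alpha> of (i, j) \<Rightarrow> mat_adjoint (?B j) * ?B i) *\<^sub>v y) \<bullet>c y"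
      have eq: "((mat_adjoint (?B j) * ?B i) *\<^sub>v x) \<bullet>c x = ((mat_adjoint (?B j) * ?B i) *\<^sub>v y) \<bullet>c y"
        if "i < m" "j < m" for i j
        using bspec[OF forms, of "(i, j)"] that by simp
      have entry: "((mat_adjoint (?B j) * ?B i) *\<^sub>v z) \<bullet>c z = \<Phi> (rank_one_proj z) $$ (i, j)"
        if "i < m" "j < m" "unit_vector n z" for i j z
        unfolding quadratic_form_adjoint_mult[OF B B unit[OF that(3)]]
        by (rule complementary_kraus_quadratic_form[OF K unit[OF that(3)] that(1,2)])
      have "\<Phi> (rank_one_proj x) \<in> carrier_mat m m" "\<Phi> (rank_one_proj y) \<in> carrier_mat m m"
        using x y unit by (auto intro: kraus_image_carrier[OF K])
      then have "\<Phi> (rank_one_proj x) = \<Phi> (rank_one_proj y)"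
        using eq x y by (intro eq_matI) (auto simp flip: entry)
      then show "\<exists>\<theta>::real. x = exp (\<i> * complex_of_real \<theta>) \<cdot>\<^sub>v y"
        using pr x y inj_iff rank_one_proj_eq_iff[OF x y] by blast
    qed
    then show "psic_channel n r (complementary_channel r A)"
      using quantum_channel_complementary[OF assms] kraus_complementary[OF K]
      unfolding psic_channel_def by blast
  next
    assume "psic_channel n r (complementary_channel r A)"
    then obtain s C where C: "kraus_representation n r (complementary_channel r A) s C"
      and psic: "psic_family n ({..<s} \<times> {..<s}) (\<lambda>(i, j). mat_adjoint (C j) * C i)"
      by (auto simp: psic_channel_def)
    show "phase_retrievable n m \<Phi>"
      unfolding inj_iff
    proof (intro allI impI)
      fix x y assume x: "unit_vector n x" and y: "unit_vector n y"
        and eq: "\<Phi> (rank_one_proj x) = \<Phi> (rank_one_proj y)"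
      have "\<forall>\<alpha>\<in>{..<s} \<times> {..<s}. ((case \<alpha> of (i, j) \<Rightarrow> mat_adjoint (C j) * C i) *\<^sub>v x) \<bullet>c x
                              = ((case \<alpha> of (i, j) \<Rightarrow> mat_adjoint (C j) * C i) *\<^sub>v y) \<bullet>c y"
        using kraus_quadratic_form_determined[OF K C unit[OF x] unit[OF y] eq] by auto
      then show "rank_one_proj x = rank_one_proj y"
        using psic x y unfolding psic_family_def rank_one_proj_eq_iff[OF x y] by blast
    qed
  qed
qed

end
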